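(* Let $n$ be a positive integer. A set $S=\{h,i\}\subseteq\{1,\ldots,2n\}$ with $h<i$ is an $n$-admissible lucky set if and only if $h=1$ and either (1) $i>n$ and $i$ is odd, or (2) $i\le n$.
   Context: A Stirling permutation of order $n$ is a permutation $w = w(1)w(2)\cdots w(2n)$ of the multiset $\{1,1,2,2,\ldots,n,n\}$ such that any value $j$ appearing between the two instances of $i$ satisfies $j>i$. $Q_n$ denotes the set of Stirling permutations of order $n$. Parking interpretation: there is a one-way street with spots $1,\ldots,2n$ (in this order), and cars $1,2,\ldots,2n$ arrive in order, car $i$ having preferred spot $w(i)$. Car $i$ parks in spot $w(i)$ if it is available; otherwise it continues down the street and parks in the first available spot after $w(i)$. For every $w\in Q_n$ all cars park. Car $i$ is lucky if it parks in its preferred spot $w(i)$, and unlucky otherwise. $\mathrm{Lucky}(w)\subseteq\{1,\ldots,2n\}$ denotes the set of lucky cars (car indices) of $w$. A subset $S\subseteq\{1,\ldots,2n\}$ is an $n$-admissible lucky set if there exists $w\in Q_n$ such that $\mathrm{Lucky}(w)=S$. *)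

theory Defs
  imports Main "HOL-Library.Multiset"
begin

text \<open>
  A word \<open>w(1) w(2) \<dots> w(2n)\<close> is a list, so \<open>w(i)\<close> is \<open>w ! (i - 1)\<close>.
\<close>

definition stirling_perms :: "nat \<Rightarrow> nat list set" where
  "stirling_perms n =
     {w. mset w = mset_set {1..n} + mset_set {1..n} \<and>
         (\<forall>a b c. a < b \<and> b < c \<and> c < length w \<and> w ! a = w ! c \<longrightarrow> w ! b > w ! a)}"

text \<open>
  The spot taken by a car with preference \<open>p\<close> on a street with spots \<open>1, \<dots>, m\<close>
  when the spots in \<open>occ\<close> are taken; \<open>None\<close> if the car leaves the street without parking.
\<close>

definition parking_spot :: "nat \<Rightarrow> nat set \<Rightarrow> nat \<Rightarrow> nat option" where
  "parking_spot m occ p =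
     (if {p..m} - occ = {} then None else Some (Min ({p..m} - occ)))"

fun park :: "nat \<Rightarrow> nat set \<Rightarrow> nat list \<Rightarrow> nat option list" where
  "park m occ [] = []"
| "park m occ (p # ps) =
     (let s = parking_spot m occ p in s # park m (occ \<union> set_option s) ps)"

text \<open>Cars are numbered from 1; there are as many spots as cars.\<close>

definition lucky :: "nat list \<Rightarrow> nat set" where
  "lucky w = {i \<in> {1..length w}. park (length w) {} w ! (i - 1) = Some (w ! (i - 1))}"

definition admissible_lucky_set :: "nat \<Rightarrow> nat set \<Rightarrow> bool" where
  "admissible_lucky_set n S \<longleftrightarrow>
     S \<subseteq> {1..2 * n} \<and> (\<exists>w \<in> stirling_perms n. lucky w = S)"

end

theory Submission
  imports Defs
begin

text \<open>
  Spot 1 can only be filled by the first car preferring it, so that car is lucky, as is car 1.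
  If \<open>w\<close> starts with 1, the cars before the second lucky car \<open>i\<close> fill the spots \<open>1, \<dots>, i - 1\<close>, so
  \<open>i \<le> w(i) \<le> n\<close>. Otherwise \<open>w(i)\<close> is the first 1; no value can occur on both sides of it, so
  \<open>i - 1\<close> is even. Conversely, for odd \<open>i = 2k + 1\<close> the word
  \<open>(n-k+1)(n-k+1) \<dots> n n 1 1 \<dots> (n-k)(n-k)\<close> works, and for \<open>i \<le> n\<close> one moves the two
  copies of \<open>i\<close> in \<open>1 1 2 2 \<dots> n n\<close> to the positions \<open>i\<close> and \<open>i + 1\<close>.
\<close>

section \<open>Occupied spots\<close>

text \<open>Tracks only the set of taken spots, not who parked where, so that it splits along list
  append.\<close>

fun occupied :: "nat \<Rightarrow> nat set \<Rightarrow> nat list \<Rightarrow> nat set" where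
  "occupied m U [] = U"
| "occupied m U (p # ps) = occupied m (U \<union> set_option (parking_spot m U p)) ps"

lemma occupied_append: "occupied m U (u @ v) = occupied m (occupied m U u) v"
  by (induction u arbitrary: U) auto

lemma park_nth:
  "j < length w \<Longrightarrow> park m U w ! j = parking_spot m (occupied m U (take j w)) (w ! j)"
proof (induction w arbitrary: U j)
  case (Cons p ps)
  then show ?case by (cases j) (auto simp: Let_def)
qed simp

lemma parking_spot_eq_Some_iff: "parking_spot m U p = Some p \<longleftrightarrow> p \<le> m \<and> p \<notin> U"
proof
  assume *: "parking_spot m U p = Some p"
  then have ne: "{p..m} - U \<noteq> {}" and "Min ({p..m} - U) = p"
    by (auto simp: parking_spot_def split: if_splits)
  moreover have "Min ({p..m} - U) \<in> {p..m} - U"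
    using ne by (intro Min_in) auto
  ultimately show "p \<le> m \<and> p \<notin> U" by auto
next
  assume "p \<le> m \<and> p \<notin> U"
  then have mem: "p \<in> {p..m} - U" by auto
  then have "Min ({p..m} - U) = p" by (intro Min_eqI) auto
  with mem show "parking_spot m U p = Some p" by (auto simp: parking_spot_def)
qed

lemma parking_spot_ge:
  assumes "s \<in> set_option (parking_spot m U p)"
  shows "p \<le> s"
proof -
  have ne: "{p..m} - U \<noteq> {}" and s: "s = Min ({p..m} - U)"
    using assms by (auto simp: parking_spot_def split: if_splits)
  have "Min ({p..m} - U) \<in> {p..m} - U"
    using ne by (intro Min_in) auto
  then show ?thesis using s by auto
qed

text \<open>Either \<open>s\<close> was taken before, or it is the least free spot from
  \<open>p\<close> on.\<close>

lemma first_free_spot_filled: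
  assumes "p \<le> s" "s \<le> m" "{p..<s} \<subseteq> U"
  shows "s \<in> U \<union> set_option (parking_spot m U p)"
proof (cases "s \<in> U")
  case False
  then have mem: "s \<in> {p..m} - U" using assms by auto
  have "Min ({p..m} - U) = s"
    using mem assms(3) by (intro Min_eqI) (auto simp: subset_iff not_less[symmetric])
  with mem show ?thesis by (auto simp: parking_spot_def)
qed simp

lemma occupied_mono: "U \<subseteq> occupied m U w"
  by (induction w arbitrary: U) fastforce+

lemma occupied_snoc:
  "occupied m U (w @ [p]) = occupied m U w \<union> set_option (parking_spot m (occupied m U w) p)"
  by (simp add: occupied_append)

text \<open>Cars only move down the street, so none parks before its preference.\<close>

lemma occupied_ge:
  assumes "\<And>p. p \<in> set w \<Longrightarrow> b \<le> p" "s \<in> occupied m {} w"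
  shows "b \<le> s"
  using assms
proof (induction w rule: rev_induct)
  case (snoc p w)
  then show ?case
    using parking_spot_ge[of s m "occupied m {} w" p] by (fastforce simp: occupied_snoc)
qed simp

text \<open>Each car adds at most one spot. This bound turns an inclusion between occupied sets into
  an equality.\<close>

lemma card_occupied: "finite (occupied m {} w) \<and> card (occupied m {} w) \<le> length w"
proof (induction w rule: rev_induct)
  case (snoc p w)
  then show ?case
    by (cases "parking_spot m (occupied m {} w) p")
      (auto simp: occupied_snoc intro: order_trans[OF card_insert_le_m1])
qed simp

text \<open>By induction, the spots from \<open>c\<close> up to \<open>c + q - 1\<close> are taken
  when the car at position \<open>q\<close> arrives; its preference lies in
  \<open>{c..c + q}\<close>, so spot \<open>c + q\<close> is taken afterwards. The set
  \<open>U\<close> is arbitrary, as other cars may have parked earlier.\<close>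

lemma occupied_fill:
  assumes "\<And>q. q < length w \<Longrightarrow> c \<le> w ! q \<and> w ! q \<le> c + q" "c + length w \<le> Suc m"
  shows "{c..<c + length w} \<subseteq> occupied m U w"
  using assms
proof (induction w rule: rev_induct)
  case (snoc p w)
  have "c \<le> w ! q \<and> w ! q \<le> c + q" if "q < length w" for q
    using snoc.prems(1)[of q] that by (simp add: nth_append)
  then have IH: "{c..<c + length w} \<subseteq> occupied m U w"
    using snoc.IH snoc.prems(2) by simp
  have p: "c \<le> p" "p \<le> c + length w"
    using snoc.prems(1)[of "length w"] by auto
  have "c + length w \<in> occupied m U (w @ [p])"
    unfolding occupied_snoc
    by (rule first_free_spot_filled) (use p IH snoc.prems(2) in auto)
  with IH show ?case
    by (auto simp: occupied_snoc less_Suc_eq atLeastLessThanSuc)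
qed simp

text \<open>Filling gives one inclusion, and counting cars excludes any further spot.\<close>

lemma occupied_eq_initial_segment:
  assumes "\<And>q. q < length w \<Longrightarrow> 1 \<le> w ! q \<and> w ! q \<le> Suc q" "length w \<le> m"
  shows "occupied m {} w = {1..length w}"
proof -
  have "{1..<1 + length w} \<subseteq> occupied m {} w"
    by (rule occupied_fill) (use assms in auto)
  then have "{1..length w} \<subseteq> occupied m {} w" by auto
  then show ?thesis
    using card_occupied[of m w] by (metis card_atLeastAtMost card_seteq diff_Suc_1)
qed

section \<open>Luckiness in terms of occupied spots\<close>

lemma Suc_mem_lucky_iff:
  assumes "j < length w" "w ! j \<le> length w"
  shows "Suc j \<in> lucky w \<longleftrightarrow> w ! j \<notin> occupied (length w) {} (take j w)"
  using assms by (auto simp: lucky_def park_nth parking_spot_eq_Some_iff)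

lemma lucky_eqI:
  assumes "set w \<subseteq> {..length w}" "S \<subseteq> {1..length w}"
    and "\<And>j. j < length w \<Longrightarrow> w ! j \<notin> occupied (length w) {} (take j w) \<longleftrightarrow> Suc j \<in> S"
  shows "lucky w = S"
proof -
  have "Suc j \<in> lucky w \<longleftrightarrow> Suc j \<in> S" if "j < length w" for j
  proof -
    have "w ! j \<le> length w" using assms(1) nth_mem[OF that] by blast
    from Suc_mem_lucky_iff[OF that this] assms(3)[OF that] show ?thesis by simp
  qed
  moreover have "lucky w \<subseteq> {1..length w}" by (auto simp: lucky_def)
  moreover have "\<exists>j < length w. i = Suc j" if "i \<in> {1..length w}" for i
    using that by (cases i) auto
  ultimately show ?thesis using assms(2) by blast
qed

section \<open>Necessity\<close>

lemma stirling_perms_set: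
  assumes "w \<in> stirling_perms n"
  shows "set w = {1..n}" "length w = 2 * n"
proof -
  have m: "mset w = mset_set {1..n} + mset_set {1..n}"
    using assms by (auto simp: stirling_perms_def)
  then show "length w = 2 * n" by (metis size_mset size_union size_mset_set card_atLeastAtMost
        diff_Suc_1 mult_2)
  have "set_mset (mset w) = {1..n}" using m by simp
  then show "set w = {1..n}" by simp
qed

text \<open>A value on both sides of the first 1 would enclose a smaller value. Hence each value
  occurs 0 or 2 times in the prefix, whose length is the sum of these counts.\<close>

lemma even_position_of_first_one:
  assumes w: "w \<in> stirling_perms n" and j: "j < length w" "w ! j = 1" "1 \<notin> set (take j w)"
  shows "even j"
proof -
  have mset: "mset w = mset_set {1..n} + mset_set {1..n}"
    and st: "\<And>a b c. a < b \<Longrightarrow> b < c \<Longrightarrow> c < length w \<Longrightarrow> w ! a = w ! c \<Longrightarrow> w ! a < w ! b"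
    using w by (auto simp: stirling_perms_def)
  have even: "even (count (mset (take j w)) x)" for x
  proof (cases "x \<in> set (take j w)")
    case True
    then obtain a where a: "a < j" "w ! a = x" using j(1) by (auto simp: in_set_conv_nth)
    then have x: "x \<in> {1..n}" using stirling_perms_set(1)[OF w] nth_mem[of a w] j(1) by simp
    have "x \<notin> set (drop j w)"
    proof
      assume "x \<in> set (drop j w)"
      then obtain c where c: "c < length w - j" "w ! (j + c) = x"
        by (auto simp: in_set_conv_nth)
      show False
      \<comment> \<open>For \<open>c = 0\<close> the letter is the 1 at position \<open>j\<close>,
        which the prefix lacks; otherwise this 1 lies strictly between two copies of
        \<open>x\<close>.\<close>
      proof (cases "c = 0")
        case True
        then show False using c j \<open>x \<in> set (take j w)\<close> by simp
      next
        case False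
        then have "w ! a < w ! j" using a c by (intro st[of a j "j + c"]) auto
        then show False using a x j by simp
      qed
    qed
    then have "count (mset (take j w)) x = count (mset (take j w @ drop j w)) x"
      by (simp only: mset_append count_union) (simp add: count_eq_zero_iff)
    also have "\<dots> = count (mset_set {1..n} + mset_set {1..n}) x"
      by (simp add: mset)
    finally show ?thesis by simp
  next
    case False
    then have "count (mset (take j w)) x = 0"
      by (metis count_eq_zero_iff set_mset_mset)
    then show ?thesis by (rule ssubst) simp
  qed
  have "even (size (mset (take j w)))"
    unfolding size_multiset_overloaded_eq by (rule dvd_sum) (rule even)
  then show ?thesis using j(1) by simp
qed

lemma lucky_pair_necessary:
  assumes w: "w \<in> stirling_perms n" and "n \<ge> 1" "h < i" and L: "lucky w = {h, i}"
  shows "h = 1 \<and> (odd i \<or> i \<le> n)"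
proof -
  note sw = stirling_perms_set[OF w]
  have bd: "1 \<le> w ! j \<and> w ! j \<le> n" if "j < length w" for j
    using sw(1) nth_mem[OF that] by auto
  have lucky_iff: "Suc j \<in> {h, i} \<longleftrightarrow> w ! j \<notin> occupied (length w) {} (take j w)"
    if "j < length w" for j
    using Suc_mem_lucky_iff[OF that] bd[OF that] sw(2) L by simp
  have range: "{h, i} \<subseteq> {1..length w}" using L by (auto simp: lucky_def)
  have h: "h = 1" using lucky_iff[of 0] sw(2) \<open>n \<ge> 1\<close> \<open>h < i\<close> range by auto
  have "1 \<in> set w" using sw(1) \<open>n \<ge> 1\<close> by simp
  then obtain us vs where split: "w = us @ 1 # vs" "1 \<notin> set us"
    using split_list_first[of 1 w] by auto
  define j where "j = length us"
  have j: "j < length w" "w ! j = 1" and before: "1 \<notin> set (take j w)"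
    using split by (auto simp: j_def)
  \<comment> \<open>Cars before the first 1 never reach spot 1, so the car at position
    \<open>j\<close> is lucky.\<close>
  have "2 \<le> p" if "p \<in> set (take j w)" for p
    using that before sw(1) in_set_takeD[OF that] by (cases "p = 1") auto
  from occupied_ge[OF this] have "w ! j \<notin> occupied (length w) {} (take j w)"
    using j(2) by fastforce
  then have "Suc j \<in> {h, i}" using lucky_iff[OF j(1)] by simp
  then consider "Suc j = i" | "j = 0" using h by auto
  then have "odd i \<or> i \<le> n"
  proof cases
    case 1
    then show ?thesis using even_position_of_first_one[OF w j(1,2) before] by auto
  next
    case 2
    \<comment> \<open>Strong induction: the earlier cars occupy exactly \<open>{1..q}\<close>, and
      for \<open>q > 0\<close> this car is unlucky, so it prefers one of these spots.\<close>
    have small: "w ! q \<le> Suc q" if "Suc q < i" for q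
      using that
    proof (induction q rule: less_induct)
      case (less q)
      have q: "q < length w" using less.prems range by auto
      have occ: "occupied (length w) {} (take q w) = {1..q}"
        using occupied_eq_initial_segment[of "take q w" "length w"] less bd q by simp
      show ?case
        using 2 j(2) lucky_iff[OF q] less.prems h occ by (cases "q = 0") auto
    qed
    obtain q where q: "i = Suc q" using \<open>h < i\<close> by (cases i) auto
    then have ql: "q < length w" using range by auto
    have "occupied (length w) {} (take q w) = {1..q}"
      using occupied_eq_initial_segment[of "take q w" "length w"] small bd q ql by simp
    \<comment> \<open>The lucky car \<open>i\<close> must prefer a spot beyond
      \<open>q = i - 1\<close>, while all preferences are at most \<open>n\<close>.\<close>
    then have "w ! q \<notin> {1..q}" using lucky_iff[OF ql] q by simp
    then show ?thesis using bd[OF ql] q by auto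
  qed
  with h show ?thesis by simp
qed

section \<open>Sufficiency\<close>

definition nested :: "nat list \<Rightarrow> bool" where
  "nested w \<longleftrightarrow> (\<forall>a b c. a < b \<and> b < c \<and> c < length w \<and> w ! a = w ! c \<longrightarrow> w ! b > w ! a)"

fun dup :: "'a list \<Rightarrow> 'a list" where
  "dup [] = []"
| "dup (x # xs) = x # x # dup xs"

lemma length_dup [simp]: "length (dup xs) = 2 * length xs"
  by (induction xs) auto

lemma mset_dup: "mset (dup xs) = mset xs + mset xs"
  by (induction xs) auto

lemma nth_dup: "j < 2 * length xs \<Longrightarrow> dup xs ! j = xs ! (j div 2)"
proof (induction xs arbitrary: j)
  case (Cons x xs)
  consider "j = 0" | "j = 1" | k where "j = Suc (Suc k)" by (metis One_nat_def not0_implies_Suc)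
  then show ?case using Cons by cases auto
qed simp

text \<open>Equal letters are adjacent, so nothing lies between them.\<close>

lemma nested_dup:
  assumes "distinct xs"
  shows "nested (dup xs)"
  unfolding nested_def
proof (intro allI impI, elim conjE)
  fix a b c
  assume *: "a < b" "b < c" "c < length (dup xs)" "dup xs ! a = dup xs ! c"
  then have "xs ! (a div 2) = xs ! (c div 2)" by (simp add: nth_dup)
  then have "a div 2 = c div 2"
    using * by (subst (asm) nth_eq_iff_index_eq[OF assms]) auto
  with * show "dup xs ! a < dup xs ! b" by linarith
qed

text \<open>The new copies of \<open>x\<close> are adjacent and the only ones; equal letters
  enclosing them have a copy in \<open>u\<close>, hence are smaller than \<open>x\<close>.\<close>

lemma nested_insert_pair:
  assumes uv: "nested (u @ v)" and x: "\<And>y. y \<in> set u \<Longrightarrow> y < x" "x \<notin> set v"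
  shows "nested (u @ [x, x] @ v)" (is "nested ?w")
  unfolding nested_def
proof (intro allI impI, elim conjE)
  fix a b c
  let ?l = "length u"
  assume *: "a < b" "b < c" "c < length ?w" "?w ! a = ?w ! c"
  \<comment> \<open>Maps positions outside the inserted pair to positions in \<open>u @ v\<close>;
    it is strictly increasing there.\<close>
  define f where "f j = (if j < ?l then j else j - 2)" for j
  have outside: "?w ! j = (u @ v) ! f j" if "j < ?l \<or> ?l + 2 \<le> j" for j
    using that by (auto simp: f_def nth_append nth_Cons' numeral_2_eq_2)
  have inside: "?w ! j = x" if "j = ?l \<or> j = Suc ?l" for j
    using that by (auto simp: nth_append)
  have low: "?w ! j < x" if "j < ?l" for j
    using that x(1) by (auto simp: nth_append)
  have high: "?w ! j \<noteq> x" if "?l + 2 \<le> j" "j < length ?w" for j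
  proof -
    have "?w ! j = v ! (j - ?l - 2)" "j - ?l - 2 < length v"
      using that by (auto simp: nth_append nth_Cons' numeral_2_eq_2)
    then show ?thesis using x(2) nth_mem by metis
  qed
  \<comment> \<open>If \<open>c\<close> were in the pair, \<open>a\<close> would lie in
    \<open>u\<close>, where all letters are below \<open>x\<close>.\<close>
  have c: "c < ?l \<or> ?l + 2 \<le> c"
  proof (rule ccontr)
    assume "\<not> ?thesis"
    then have "c = ?l \<or> c = Suc ?l" by linarith
    moreover from this have "a < ?l" using *(1,2) by linarith
    ultimately show False using inside[of c] low[of a] *(4) by (metis less_irrefl)
  qed
  have a: "a < ?l \<or> ?l + 2 \<le> a"
  proof (rule ccontr)
    assume "\<not> ?thesis"
    then have "a = ?l \<or> a = Suc ?l" by linarith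
    moreover from this have "?l + 2 \<le> c" using *(1,2) c by linarith
    ultimately show False using inside[of a] high[of c] *(3,4) by metis
  qed
  show "?w ! a < ?w ! b"
  proof (cases "b = ?l \<or> b = Suc ?l")
    case True
    then show ?thesis using inside[OF True] low[of a] a * by auto
  next
    case False
    then have b: "b < ?l \<or> ?l + 2 \<le> b" by auto
    have "f a < f b" "f b < f c" "f c < length (u @ v)"
      using a b c * by (auto simp: f_def)
    then show ?thesis
      using uv * outside[OF a] outside[OF b] outside[OF c] unfolding nested_def by metis
  qed
qed

lemma stirling_perms_nested:
  "w \<in> stirling_perms n \<longleftrightarrow> mset w = mset_set {1..n} + mset_set {1..n} \<and> nested w"
  by (auto simp: stirling_perms_def nested_def)

section \<open>Words realising the admissible pairs\<close>

lemma admissible_odd: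
  assumes "1 \<le> k" "k < n"
  shows "\<exists>w \<in> stirling_perms n. lucky w = {1, 2 * k + 1}"
proof -
  \<comment> \<open>The \<open>k\<close> largest values start at \<open>a\<close>; their
    \<open>2 * k\<close> cars come first and fill \<open>{a..<a + 2 * k}\<close>, leaving spot 1
    free.\<close>
  define a where "a = Suc (n - k)"
  define xs where "xs = [a..<Suc n] @ [1..<a]"
  define w where "w = dup xs"
  have lxs: "length xs = n" using assms by (auto simp: xs_def a_def)
  have lw: "length w = 2 * n" by (simp add: w_def lxs)
  have set_xs: "set xs = {1..n}" using assms by (auto simp: xs_def a_def)
  have dist: "distinct xs" by (auto simp: xs_def)
  have "mset xs = mset_set {1..n}" using mset_set_set[OF dist] set_xs by simp
  then have st: "w \<in> stirling_perms n"
    by (simp add: stirling_perms_nested w_def mset_dup nested_dup dist)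
  have xs1: "xs ! q = a + q" if "q < k" for q
    using that assms by (simp add: xs_def nth_append a_def del: upt_Suc)
  have xs2: "xs ! (k + q) = Suc q" if "k + q < n" for q
    using that assms by (simp add: xs_def nth_append a_def del: upt_Suc)
  have w1: "w ! j = a + j div 2" if "j < 2 * k" for j
    using that assms by (simp add: w_def nth_dup lxs xs1)
  have w2: "w ! (2 * k + j) = Suc (j div 2)" if "2 * k + j < 2 * n" for j
    using that by (simp add: w_def nth_dup lxs xs2)
  have fill1: "{a..<a + j} \<subseteq> occupied (2 * n) {} (take j w)" if "j \<le> 2 * k" for j
  proof -
    have "a + j \<le> Suc (2 * n)" using that assms by (simp add: a_def)
    moreover have "j div 2 \<le> j" for j :: nat by simp
    ultimately show ?thesis
      using occupied_fill[of "take j w" a "2 * n" "{}"] that assms lw by (simp add: w1)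
  qed
  have low: "2 \<le> p" if "p \<in> set (take (2 * k) w)" for p
    using that assms lw w1 by (auto simp: in_set_conv_nth a_def)
  have fill2: "{1..j} \<subseteq> occupied (2 * n) {} (take (2 * k + j') w)"
    if j: "j \<le> j'" "j \<le> n - k" "2 * k + j' \<le> 2 * n" for j j'
  proof -
    let ?U = "occupied (2 * n) {} (take (2 * k) w)"
    have "{1..<1 + j} \<subseteq> occupied (2 * n) ?U (take j (drop (2 * k) w))"
      using occupied_fill[of "take j (drop (2 * k) w)" 1 "2 * n" ?U] j lw by (simp add: w2)
    \<comment> \<open>The first \<open>j\<close> cars of the second block already cover the
      interval; later cars only add spots.\<close>
    also have "\<dots> \<subseteq> occupied (2 * n) ?U (take j' (drop (2 * k) w))"
      using occupied_mono j(1)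
      by (metis occupied_append append_take_drop_id min.absorb1 take_take)
    finally show ?thesis
      by (simp add: take_add occupied_append atLeastLessThanSuc_atLeastAtMost)
  qed
  have "lucky w = {1, 2 * k + 1}"
  proof (rule lucky_eqI)
    show "set w \<subseteq> {..length w}" using stirling_perms_set[OF st] by auto
    show "{1, 2 * k + 1} \<subseteq> {1..length w}" using assms lw by auto
    fix j assume "j < length w"
    then have jn: "j < 2 * n" using lw by simp
    consider "j = 0" | "1 \<le> j" "j < 2 * k" | "j = 2 * k" "j \<noteq> 0" | "2 * k < j" by linarith
    then show "w ! j \<notin> occupied (length w) {} (take j w) \<longleftrightarrow> Suc j \<in> {1, 2 * k + 1}"
    proof cases
      case 2
      then have "w ! j \<in> {a..<a + j}" using w1 by auto
      then show ?thesis using fill1[of j] 2 lw by auto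
    next
      case 3
      then have "w ! j = 1" using w2[of 0] jn by simp
      moreover have "1 \<notin> occupied (2 * n) {} (take (2 * k) w)"
        using occupied_ge[OF low] by fastforce
      ultimately show ?thesis using 3 lw by simp
    next
      case 4
      then obtain r where r: "j = 2 * k + r" "1 \<le> r" by (metis less_imp_add_positive Suc_leI One_nat_def)
      \<comment> \<open>After the first 1, \<open>r\<close> cars of the second block precede the
        current one, and its preference is at most \<open>r\<close>, hence already taken.\<close>
      have "w ! j = Suc (r div 2)" "Suc (r div 2) \<le> r" "Suc (r div 2) \<le> n - k"
        using r w2 jn by auto
      moreover have "{1..Suc (r div 2)} \<subseteq> occupied (2 * n) {} (take j w)"
        using fill2[of "Suc (r div 2)" r] r jn calculation by simp
      ultimately show ?thesis using 4 lw by auto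
    qed simp
  qed
  with st show ?thesis by blast
qed

text \<open>When \<open>j\<close> cars have parked, exactly \<open>{1..j}\<close> is taken, so a car
  is lucky iff its preference exceeds the number of its predecessors. This happens only for cars 1
  and \<open>i\<close>.\<close>

lemma admissible_small:
  assumes "2 \<le> i" "i \<le> n"
  shows "\<exists>w \<in> stirling_perms n. lucky w = {1, i}"
proof -
  define xs where "xs = [1..<i] @ [Suc i..<Suc n]"
  \<comment> \<open>For even \<open>i\<close> this cut separates the two copies of
    \<open>i div 2\<close>; inserting \<open>i\<close> between them is harmless, as it is
    larger.\<close>
  define u where "u = take (i - 1) (dup xs)"
  define v where "v = drop (i - 1) (dup xs)"
  define w where "w = u @ [i, i] @ v"
  have lxs: "length xs = n - 1" using assms by (auto simp: xs_def)
  have lu: "length u = i - 1" using assms by (simp add: u_def lxs)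
  have dist: "distinct xs" by (auto simp: xs_def)
  have set_xs: "insert i (set xs) = {1..n}" "i \<notin> set xs" using assms by (auto simp: xs_def)
  have uv: "u @ v = dup xs" by (simp add: u_def v_def)
  have xs_low: "xs ! q = Suc q" if "q < i - 1" for q
    using that by (simp add: xs_def nth_append)
  \<comment> \<open>Leaving out \<open>i\<close> raises the later entries by one, whence
    \<open>q + 2\<close> in place of \<open>q + 1\<close>.\<close>
  have xs_bd: "1 \<le> xs ! q \<and> xs ! q \<le> q + 2" if "q < n - 1" for q
    using that assms by (auto simp: xs_def nth_append)
  have w_u: "w ! j = Suc (j div 2)" if "j < i - 1" for j
  proof -
    have "w ! j = dup xs ! j" using that lu by (simp add: w_def nth_append) (simp add: u_def)
    then show ?thesis using that assms by (simp add: nth_dup lxs xs_low)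
  qed
  have w_i: "w ! (i - 1) = i" "w ! i = i"
    using lu assms by (auto simp: w_def nth_append nth_Cons')
  have w_v: "w ! j = xs ! (j div 2 - 1)" if "i < j" "j < 2 * n" for j
  proof -
    have "w ! j = v ! (j - Suc i)"
      using that lu assms nth_append_right[of "u @ [i, i]" j v] by (simp add: w_def)
    also have "\<dots> = dup xs ! (j - 2)" using that assms by (simp add: v_def lxs)
    also have "\<dots> = xs ! ((j - 2) div 2)" using that assms by (intro nth_dup) (auto simp: lxs)
    \<comment> \<open>The inserted pair shifts later positions by two, that is, by one doubled
      letter.\<close>
    also have "(j - 2) div 2 = j div 2 - 1" by presburger
    finally show ?thesis .
  qed
  have "mset w = mset (i # xs) + mset (i # xs)"
    by (simp add: w_def) (metis mset_append mset_dup uv)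
  also have "mset (i # xs) = mset_set {1..n}"
    using mset_set_set[of "i # xs"] dist set_xs by simp
  finally have mset: "mset w = mset_set {1..n} + mset_set {1..n}" .
  have "y < i" if "y \<in> set u" for y
  proof -
    from that obtain j where "j < i - 1" "y = u ! j" using lu by (auto simp: in_set_conv_nth)
    then have "y = Suc (j div 2)" using w_u[of j] lu by (simp add: w_def nth_append)
    then show ?thesis using \<open>j < i - 1\<close> by linarith
  qed
  moreover have "set (dup xs) = set xs"
    by (metis mset_dup set_mset_mset set_mset_union Un_absorb)
  then have "i \<notin> set v" using set_xs(2) unfolding v_def by (metis in_set_dropD)
  ultimately have "nested w"
    unfolding w_def by (intro nested_insert_pair) (auto simp: uv nested_dup dist)
  with mset have st: "w \<in> stirling_perms n" by (simp add: stirling_perms_nested)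
  have lw: "length w = 2 * n" using stirling_perms_set[OF st] by simp
  have bd: "1 \<le> w ! j" if "j < 2 * n" for j
    using stirling_perms_set[OF st] nth_mem[of j w] that by auto
  have le: "w ! j \<le> j" if j: "j < 2 * n" "j \<noteq> 0" "j \<noteq> i - 1" for j
  proof -
    consider "j < i - 1" | "j = i" | "i < j" using j by linarith
    then show ?thesis
    proof cases
      case 3
      then have "w ! j \<le> j div 2 - 1 + 2"
        using w_v[OF 3 j(1)] xs_bd[of "j div 2 - 1"] j assms by auto
      then show ?thesis using 3 assms by linarith
    qed (use w_u w_i j in auto)
  qed
  have w0: "w ! 0 = 1" using w_u[of 0] assms by simp
  have Suc_le: "w ! j \<le> Suc j" if "j < 2 * n" for j
    using le[OF that] w0 w_i assms by (cases "j = 0 \<or> j = i - 1") auto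
  have "lucky w = {1, i}"
  proof (rule lucky_eqI)
    show "set w \<subseteq> {..length w}" using stirling_perms_set[OF st] by auto
    show "{1, i} \<subseteq> {1..length w}" using assms lw by auto
    fix j assume j: "j < length w"
    then have "occupied (length w) {} (take j w) = {1..j}"
      using occupied_eq_initial_segment[of "take j w" "length w"] bd Suc_le lw by simp
    then have "w ! j \<notin> occupied (length w) {} (take j w) \<longleftrightarrow> j < w ! j"
      using bd[of j] j lw by auto
    also have "\<dots> \<longleftrightarrow> j = 0 \<or> j = i - 1"
    proof (cases "j = 0 \<or> j = i - 1")
      case True
      then have "w ! j = Suc j"
      proof
        assume "j = i - 1"
        then show ?thesis using w_i(1) assms(1) by simp
      qed (use w0 in simp)
      with True show ?thesis by simp
    next
      case False
      then show ?thesis using le[of j] j lw by simp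
    qed
    also have "\<dots> \<longleftrightarrow> Suc j \<in> {1, i}" using assms(1) by auto
    finally show "w ! j \<notin> occupied (length w) {} (take j w) \<longleftrightarrow> Suc j \<in> {1, i}" .
  qed
  with st show ?thesis by blast
qed

theorem theorem4p1:
  fixes n h i :: nat
  assumes "n \<ge> 1"
    and "{h, i} \<subseteq> {1..2 * n}"
    and "h < i"
  shows "admissible_lucky_set n {h, i} \<longleftrightarrow>
           h = 1 \<and> ((i > n \<and> odd i) \<or> i \<le> n)"
proof
  assume "admissible_lucky_set n {h, i}"
  then obtain w where "w \<in> stirling_perms n" "lucky w = {h, i}"
    by (auto simp: admissible_lucky_set_def)
  from lucky_pair_necessary[OF this(1) assms(1,3) this(2)]
  show "h = 1 \<and> ((i > n \<and> odd i) \<or> i \<le> n)" by auto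
next
  assume *: "h = 1 \<and> ((i > n \<and> odd i) \<or> i \<le> n)"
  have "\<exists>w \<in> stirling_perms n. lucky w = {1, i}"
  proof (cases "i \<le> n")
    case True
    then show ?thesis using admissible_small * assms(3) by simp
  next
    case False
    \<comment> \<open>Here \<open>1 < i\<close> and \<open>i \<le> 2 * n\<close> yield
      \<open>1 \<le> k\<close> and \<open>k < n\<close>.\<close>
    then obtain k where k: "i = 2 * k + 1" using * by (auto elim: oddE)
    then show ?thesis using admissible_odd[of k n] * assms by auto
  qed
  then show "admissible_lucky_set n {h, i}"
    using * assms(2) by (simp add: admissible_lucky_set_def)
qed

end
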